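(* Let $\gamma:I\to S^n\subset\mathbb R^{n+1}$ be a smooth curve on an interval $I\subset\mathbb R$, parametrized by arc length. Then $\gamma$ is a $3$-harmonic curve if and only if $$\gamma^{(6)}+2\gamma^{(4)}+(2-g_{22})\gamma''-4g_{23}\gamma'+(2-3g_{22}-9g_{24}-8g_{33})\gamma=0,$$ where $g_{ij}=g_0(\gamma^{(i)},\gamma^{(j)})$ $(i,j=0,1,\dots)$ and $g_0$ is the standard metric on $\mathbb R^{n+1}$.
   Context: $S^n$ is the unit sphere with its standard metric of constant sectional curvature $1$, Levi-Civita connection $\nabla$ and curvature tensor $R(X,Y)=\nabla_X\nabla_Y-\nabla_Y\nabla_X-\nabla_{[X,Y]}$; $\gamma^{(i)}$ denotes the $i$-th derivative of $\gamma$ as an $\mathbb R^{n+1}$-valued function. For a unit-speed curve $\gamma$ in $S^n$ put $\tau(\gamma)=\nabla_{\gamma'}\gamma'$ and, for vector fields $V$ along $\gamma$, $\overline\Delta V=-\nabla_{\gamma'}\nabla_{\gamma'}V$. For $k\ge2$, $\gamma$ is $k$-harmonic if $\tau_k(\gamma):=\overline\Delta^{k-1}\tau(\gamma)-R\big(\overline\Delta^{k-2}\tau(\gamma),\gamma'\big)\gamma'=0$. *)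

theory Defs
  imports "HOL-Analysis.Analysis"
begin

section \<open>The unit sphere and its Levi-Civita connection\<close>

text \<open>
  The unit sphere of a Euclidean space \<open>'a\<close> (with \<open>DIM('a) = n + 1\<close>) is \<open>sphere 0 1\<close>, its metric is
  the restriction of the inner product, and the tangent space at \<open>p\<close> is \<open>{v. v \<bullet> p = 0}\<close>. A vector
  field on the sphere is a function \<open>'a \<Rightarrow> 'a\<close> of which only the values on the sphere matter.
\<close>

definition tangent_proj :: "'a::euclidean_space \<Rightarrow> 'a \<Rightarrow> 'a" where
  "tangent_proj p v = v - (v \<bullet> p) *\<^sub>R p"

text \<open>
  Derivative along \<open>X\<close> of a function on the sphere. Composition with \<open>sgn q = q /\<^sub>R norm q\<close> extends a
  function on the sphere to a neighbourhood of it, constantly in the radial direction, so the result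
  only depends on the values of \<open>f\<close> on the sphere. For \<open>f :: 'a \<Rightarrow> real\<close> this is \<open>X(f)\<close>; a vector field
  is differentiated as an \<open>'a\<close>-valued function.
\<close>

definition dir_deriv ::
  "('a::euclidean_space \<Rightarrow> 'a) \<Rightarrow> ('a \<Rightarrow> 'b::real_normed_vector) \<Rightarrow> 'a \<Rightarrow> 'b" where
  "dir_deriv X f p = frechet_derivative (\<lambda>q. f (sgn q)) (at p) (X p)"

definition lie_bracket ::
  "('a::euclidean_space \<Rightarrow> 'a) \<Rightarrow> ('a \<Rightarrow> 'a) \<Rightarrow> 'a \<Rightarrow> 'a" where
  "lie_bracket X Y p = dir_deriv X Y p - dir_deriv Y X p"

text \<open>
  The Levi-Civita connection of the metric induced on a submanifold of a Euclidean space: the tangential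
  component of the Euclidean derivative. The lemmas \<open>nabla_metric\<close> and \<open>nabla_torsion_free\<close> below
  verify the two properties that characterize it among connections.
\<close>

definition nabla :: "('a::euclidean_space \<Rightarrow> 'a) \<Rightarrow> ('a \<Rightarrow> 'a) \<Rightarrow> 'a \<Rightarrow> 'a" where
  "nabla X Y p = tangent_proj p (dir_deriv X Y p)"

definition curvature_op ::
  "('a::euclidean_space \<Rightarrow> 'a) \<Rightarrow> ('a \<Rightarrow> 'a) \<Rightarrow> ('a \<Rightarrow> 'a) \<Rightarrow> 'a \<Rightarrow> 'a" where
  "curvature_op X Y Z p =
     nabla X (nabla Y Z) p - nabla Y (nabla X Z) p - nabla (lie_bracket X Y) Z p"

text \<open>
  The curvature tensor \<open>R(x,y)z\<close> at \<open>p\<close>, for tangent vectors \<open>x y z\<close> at \<open>p\<close>. The value of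
  \<open>R(X,Y)Z\<close> at \<open>p\<close> only depends on \<open>X p\<close>, \<open>Y p\<close>, \<open>Z p\<close>, so we may evaluate it on the tangent
  fields \<open>\<lambda>q. tangent_proj q x\<close> etc., which extend \<open>x y z\<close> to the whole sphere.
\<close>

definition curvature :: "'a::euclidean_space \<Rightarrow> 'a \<Rightarrow> 'a \<Rightarrow> 'a \<Rightarrow> 'a" where
  "curvature p x y z =
     curvature_op (\<lambda>q. tangent_proj q x) (\<lambda>q. tangent_proj q y) (\<lambda>q. tangent_proj q z) p"


section \<open>Curves\<close>

text \<open>
  The interval \<open>I\<close> need not be open; derivatives are taken within \<open>I\<close>, hence are one-sided at
  end points belonging to \<open>I\<close>.
\<close>

definition curve_deriv ::
  "real set \<Rightarrow> nat \<Rightarrow> (real \<Rightarrow> 'a::real_normed_vector) \<Rightarrow> real \<Rightarrow> 'a" where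
  "curve_deriv I i = (\<lambda>V t. vector_derivative V (at t within I)) ^^ i"

definition smooth_curve_on :: "real set \<Rightarrow> (real \<Rightarrow> 'a::real_normed_vector) \<Rightarrow> bool" where
  "smooth_curve_on I \<gamma> \<longleftrightarrow> (\<forall>i. \<forall>t\<in>I. curve_deriv I i \<gamma> differentiable (at t within I))"

text \<open>
  The covariant derivative \<open>\<nabla>\<^bsub>\<gamma>'\<^esub>V\<close> of a vector field \<open>V\<close> along a curve \<open>\<gamma>\<close> in the sphere;
  \<open>cov_deriv_restrict\<close> below shows that it is the one induced by \<open>nabla\<close>.
\<close>

definition cov_deriv ::
  "real set \<Rightarrow> (real \<Rightarrow> 'a::euclidean_space) \<Rightarrow> (real \<Rightarrow> 'a) \<Rightarrow> real \<Rightarrow> 'a" where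
  "cov_deriv I \<gamma> V t = tangent_proj (\<gamma> t) (curve_deriv I 1 V t)"

definition tension :: "real set \<Rightarrow> (real \<Rightarrow> 'a::euclidean_space) \<Rightarrow> real \<Rightarrow> 'a" where
  "tension I \<gamma> = cov_deriv I \<gamma> (curve_deriv I 1 \<gamma>)"

definition rough_laplacian ::
  "real set \<Rightarrow> (real \<Rightarrow> 'a::euclidean_space) \<Rightarrow> (real \<Rightarrow> 'a) \<Rightarrow> real \<Rightarrow> 'a" where
  "rough_laplacian I \<gamma> V t = - cov_deriv I \<gamma> (cov_deriv I \<gamma> V) t"

text \<open>Only meaningful for \<open>k \<ge> 2\<close>, because of the truncated subtraction.\<close>

definition k_tension ::
  "real set \<Rightarrow> nat \<Rightarrow> (real \<Rightarrow> 'a::euclidean_space) \<Rightarrow> real \<Rightarrow> 'a" where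
  "k_tension I k \<gamma> t =
     (rough_laplacian I \<gamma> ^^ (k - 1)) (tension I \<gamma>) t
     - curvature (\<gamma> t) ((rough_laplacian I \<gamma> ^^ (k - 2)) (tension I \<gamma>) t)
         (curve_deriv I 1 \<gamma> t) (curve_deriv I 1 \<gamma> t)"

definition k_harmonic :: "real set \<Rightarrow> nat \<Rightarrow> (real \<Rightarrow> 'a::euclidean_space) \<Rightarrow> bool" where
  "k_harmonic I k \<gamma> \<longleftrightarrow> (\<forall>t\<in>I. k_tension I k \<gamma> t = 0)"


section \<open>The connection is the Levi-Civita connection of the sphere\<close>

lemma sgn_sphere: "p \<in> sphere 0 1 \<Longrightarrow> sgn p = (p::'a::euclidean_space)"
  by (simp add: sgn_div_norm)

lemma sgn_in_sphere: "p \<noteq> 0 \<Longrightarrow> sgn p \<in> sphere (0::'a::euclidean_space) 1"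
  by (simp add: norm_sgn)

lemma sgn_sgn_vector: "sgn (sgn q) = sgn (q::'a::euclidean_space)"
  by (cases "q = 0") (auto intro!: sgn_sphere sgn_in_sphere simp del: mem_sphere)

lemma has_derivative_sgn_sphere:
  fixes p :: "'a::euclidean_space"
  assumes "p \<in> sphere 0 1"
  shows "(sgn has_derivative tangent_proj p) (at p)"
proof -
  have p: "norm p = 1" "p \<noteq> 0" using assms by auto
  have "((\<lambda>q. inverse (norm q) *\<^sub>R q) has_derivative
      (\<lambda>h. inverse (norm p) *\<^sub>R h + (- (inverse (norm p) * (h \<bullet> sgn p) * inverse (norm p))) *\<^sub>R p)) (at p)"
    using p by (auto intro!: derivative_eq_intros has_derivative_norm simp: fun_eq_iff)
  moreover have "(\<lambda>q. inverse (norm q) *\<^sub>R q) = (sgn :: 'a \<Rightarrow> 'a)"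
    by (simp add: sgn_div_norm fun_eq_iff)
  ultimately show ?thesis
    using p sgn_sphere[OF assms] by (simp add: tangent_proj_def[abs_def])
qed

lemma dir_deriv_eqI:
  fixes p :: "'a::euclidean_space"
  assumes "p \<in> sphere 0 1" "\<And>q. q \<in> sphere 0 1 \<Longrightarrow> f q = g q"
    and "((\<lambda>q. g (sgn q)) has_derivative D) (at p)"
  shows "dir_deriv X f p = D (X p)"
proof -
  have "((\<lambda>q. f (sgn q)) has_derivative D) (at p)"
    by (rule has_derivative_transform_within_open[OF assms(3), of "- {0}"])
      (use assms(1) assms(2)[OF sgn_in_sphere] in auto)
  then show ?thesis
    unfolding dir_deriv_def by (metis frechet_derivative_at)
qed

lemma dir_deriv_inner:
  fixes p :: "'a::euclidean_space" and Y Z :: "'a \<Rightarrow> 'a"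
  assumes "p \<in> sphere 0 1"
    and "(\<lambda>q. Y (sgn q)) differentiable (at p)" "(\<lambda>q. Z (sgn q)) differentiable (at p)"
  shows "dir_deriv X (\<lambda>q. Y q \<bullet> Z q) p = dir_deriv X Y p \<bullet> Z p + Y p \<bullet> dir_deriv X Z p"
proof -
  note D = assms(2,3)[unfolded frechet_derivative_works]
  show ?thesis
    using dir_deriv_eqI[OF assms(1) refl has_derivative_inner[OF D], of X] sgn_sphere[OF assms(1)]
    by (simp add: dir_deriv_def)
qed

lemma nabla_metric:
  fixes X Y Z :: "'a::euclidean_space \<Rightarrow> 'a"
  assumes "p \<in> sphere 0 1" "Y p \<bullet> p = 0" "Z p \<bullet> p = 0"
    and "(\<lambda>q. Y (sgn q)) differentiable (at p)" "(\<lambda>q. Z (sgn q)) differentiable (at p)"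
  shows "dir_deriv X (\<lambda>q. Y q \<bullet> Z q) p = nabla X Y p \<bullet> Z p + Y p \<bullet> nabla X Z p"
  using assms(2,3) dir_deriv_inner[OF assms(1,4,5)]
  by (simp add: nabla_def tangent_proj_def inner_simps inner_commute)

lemma dir_deriv_tangent_field:
  fixes X Y :: "'a::euclidean_space \<Rightarrow> 'a"
  assumes p: "p \<in> sphere 0 1" and "X p \<bullet> p = 0" and Y: "\<And>q. q \<in> sphere 0 1 \<Longrightarrow> Y q \<bullet> q = 0"
    and "(\<lambda>q. Y (sgn q)) differentiable (at p)"
  shows "dir_deriv X Y p \<bullet> p = - (Y p \<bullet> X p)"
proof -
  note s = has_derivative_sgn_sphere[OF p]
  have s': "((\<lambda>q. sgn (sgn q)) has_derivative tangent_proj p) (at p)"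
    using s by (simp add: sgn_sgn_vector)
  have "dir_deriv X (\<lambda>q. Y q \<bullet> q) p = 0"
    using dir_deriv_eqI[OF p, of "\<lambda>q. Y q \<bullet> q" "\<lambda>_. 0" "\<lambda>_. 0"] Y by simp
  moreover have "dir_deriv X (\<lambda>q. q) p = X p"
    using dir_deriv_eqI[OF p refl, of "\<lambda>q. q", OF s, of X] assms(2) by (simp add: tangent_proj_def)
  moreover have "(\<lambda>q. sgn q) differentiable (at p)"
    using s differentiable_def by blast
  ultimately show ?thesis
    using dir_deriv_inner[OF p assms(4), of "\<lambda>q. q" X] by simp
qed

lemma nabla_torsion_free:
  fixes X Y :: "'a::euclidean_space \<Rightarrow> 'a"
  assumes p: "p \<in> sphere 0 1"
    and X: "\<And>q. q \<in> sphere 0 1 \<Longrightarrow> X q \<bullet> q = 0" "(\<lambda>q. X (sgn q)) differentiable (at p)"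
    and Y: "\<And>q. q \<in> sphere 0 1 \<Longrightarrow> Y q \<bullet> q = 0" "(\<lambda>q. Y (sgn q)) differentiable (at p)"
  shows "nabla X Y p - nabla Y X p = lie_bracket X Y p"
  using dir_deriv_tangent_field[of p X Y, OF p X(1)[OF p] Y]
    dir_deriv_tangent_field[of p Y X, OF p Y(1)[OF p] X]
  by (simp add: nabla_def tangent_proj_def lie_bracket_def inner_commute)

lemma cov_deriv_restrict:
  fixes \<gamma> :: "real \<Rightarrow> 'a::euclidean_space" and X Y :: "'a \<Rightarrow> 'a"
  assumes t: "t \<in> I" "at t within I \<noteq> bot" and \<gamma>: "\<gamma> ` I \<subseteq> sphere 0 1"
    and "\<gamma> differentiable (at t within I)"
    and "X (\<gamma> t) = curve_deriv I 1 \<gamma> t"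
    and "(\<lambda>q. Y (sgn q)) differentiable (at (\<gamma> t))"
  shows "cov_deriv I \<gamma> (\<lambda>s. Y (\<gamma> s)) t = nabla X Y (\<gamma> t)"
proof -
  let ?D = "frechet_derivative (\<lambda>q. Y (sgn q)) (at (\<gamma> t))"
  have \<gamma>': "(\<gamma> has_vector_derivative X (\<gamma> t)) (at t within I)"
    using assms(4,5) by (simp add: curve_deriv_def vector_derivative_works)
  have "((\<lambda>q. Y (sgn q)) has_derivative ?D) (at (\<gamma> t))"
    using assms(6) frechet_derivative_works by blast
  then have "((\<lambda>q. Y (sgn q)) has_derivative ?D) (at (\<gamma> t) within \<gamma> ` I)"
    by (rule has_derivative_at_withinI)
  from has_derivative_in_compose[OF \<gamma>'[unfolded has_vector_derivative_def] this]
  have "((\<lambda>s. Y (sgn (\<gamma> s))) has_vector_derivative ?D (X (\<gamma> t))) (at t within I)"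
    using linear_frechet_derivative[OF assms(6)]
    by (simp add: has_vector_derivative_def linear_cmul)
  then have "((\<lambda>s. Y (\<gamma> s)) has_vector_derivative ?D (X (\<gamma> t))) (at t within I)"
    by (rule has_vector_derivative_transform[rotated 2]) (use t \<gamma> sgn_sphere in force)+
  then have "vector_derivative (\<lambda>s. Y (\<gamma> s)) (at t within I) = ?D (X (\<gamma> t))"
    using t(2) by (simp add: vector_derivative_within)
  then show ?thesis
    by (simp add: cov_deriv_def nabla_def dir_deriv_def curve_deriv_def)
qed


text \<open>The metric has constant sectional curvature 1; this also fixes the sign convention.\<close>

lemma dir_deriv_tangent_proj:
  fixes p z :: "'a::euclidean_space"
  assumes p: "p \<in> sphere 0 1" and "X p \<bullet> p = 0"
  shows "dir_deriv X (\<lambda>q. tangent_proj q z) p = - (z \<bullet> X p) *\<^sub>R p - (z \<bullet> p) *\<^sub>R X p"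
proof -
  note s = has_derivative_sgn_sphere[OF p]
  have "((\<lambda>q. tangent_proj (sgn q) z) has_derivative
      (\<lambda>h. - ((z \<bullet> tangent_proj p h) *\<^sub>R p + (z \<bullet> p) *\<^sub>R tangent_proj p h))) (at p)"
    unfolding tangent_proj_def[of "sgn _" z]
    by (auto intro!: derivative_eq_intros s simp: sgn_sphere[OF p])
  from dir_deriv_eqI[OF p refl this, of X] assms(2) show ?thesis
    by (simp add: tangent_proj_def)
qed

lemma tangent_proj_tangent:
  "p \<in> sphere 0 1 \<Longrightarrow> tangent_proj p v \<bullet> (p::'a::euclidean_space) = 0"
  by (simp add: tangent_proj_def inner_simps dot_square_norm)

lemma nabla_tangent_proj:
  fixes p z :: "'a::euclidean_space"
  assumes "p \<in> sphere 0 1" and "X p \<bullet> p = 0"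
  shows "nabla X (\<lambda>q. tangent_proj q z) p = - (z \<bullet> p) *\<^sub>R X p"
  using dir_deriv_tangent_proj[of p X z] assms
  by (simp add: nabla_def) (simp add: tangent_proj_def inner_simps dot_square_norm)

lemma curvature_sphere:
  fixes p x y z :: "'a::euclidean_space"
  assumes p: "p \<in> sphere 0 1" and tan: "x \<bullet> p = 0" "y \<bullet> p = 0" "z \<bullet> p = 0"
  shows "curvature p x y z = (y \<bullet> z) *\<^sub>R x - (x \<bullet> z) *\<^sub>R y"
proof -
  let ?E = "\<lambda>v q. tangent_proj q (v::'a)"
  have E: "?E v p = v" if "v \<bullet> p = 0" for v
    using that by (simp add: tangent_proj_def)
  have 2: "nabla (?E u) (nabla (?E v) (?E z)) p = - (z \<bullet> u) *\<^sub>R v"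
    if uv: "u \<bullet> p = 0" "v \<bullet> p = 0" for u v
  proof -
    note s = has_derivative_sgn_sphere[OF p]
    have "((\<lambda>q. - (z \<bullet> sgn q) *\<^sub>R (v - (v \<bullet> sgn q) *\<^sub>R sgn q)) has_derivative
      (\<lambda>h. - (z \<bullet> tangent_proj p h) *\<^sub>R v)) (at p)"
      using uv tan by (auto intro!: derivative_eq_intros s simp: sgn_sphere[OF p])
    then have "dir_deriv (?E u) (nabla (?E v) (?E z)) p = - (z \<bullet> tangent_proj p (?E u p)) *\<^sub>R v"
      by (intro dir_deriv_eqI[OF p, where g = "\<lambda>q. - (z \<bullet> q) *\<^sub>R (v - (v \<bullet> q) *\<^sub>R q)"])
        (auto simp: nabla_tangent_proj tangent_proj_tangent simp flip: tangent_proj_def)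
    then show ?thesis
      using uv by (simp add: nabla_def E)
  qed
  have "lie_bracket (?E x) (?E y) p = 0"
    using p tan
    by (simp add: lie_bracket_def dir_deriv_tangent_proj tangent_proj_tangent E inner_commute)
  then have "nabla (lie_bracket (?E x) (?E y)) (?E z) p = 0"
    using p tan by (simp add: nabla_tangent_proj)
  then show ?thesis
    using tan by (simp add: curvature_def curvature_op_def 2 inner_commute)
qed

end

(*
  Differentiating |\<gamma>|^2 = 1 and |\<gamma>'|^2 = 1 repeatedly expresses every product of \<gamma>^(j) with \<gamma> and \<gamma>'
  that occurs through g22, g23, g24 and g33. As the covariant derivative is the derivative followed
  by removal of the \<gamma>-component, this gives successively
    \<nabla>^2 \<tau> = \<gamma>^(4) + \<gamma>'' + (1 - g22) \<gamma>,
    \<nabla>^4 \<tau> = \<gamma>^(6) + \<gamma>^(4) + (1 - g22) \<gamma>'' - 7 g23 \<gamma>' + (1 - 2 g22 - 9 g24 - 8 g33) \<gamma>,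
  while constant curvature 1 makes the term -R(-\<nabla>^2 \<tau>, \<gamma>')\<gamma>' of the 3-tension the component of \<nabla>^2 \<tau>
  orthogonal to \<gamma>'. The 3-tension therefore equals the stated expression identically.
*)
theory Submission
  imports Defs
begin

section \<open>Derivatives within a nondegenerate interval\<close>

text \<open>A connected set with more than one point has no isolated points. This makes derivatives
  within \<open>I\<close> unique, also at end points.\<close>

lemma at_within_interval_neq_bot:
  fixes I :: "real set"
  assumes "is_interval I" "interior I \<noteq> {}" "t \<in> I"
  shows "at t within I \<noteq> bot"
proof -
  have "\<nexists>x. I = {x}"
    using assms(2) by auto
  moreover have "connected I"
    using assms(1) by (rule is_interval_connected)
  ultimately have "t islimpt I"
    using assms(3) connected_imp_perfect by blast
  then show ?thesis
    by (simp add: trivial_limit_within)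
qed

lemma has_vector_derivative_curve_deriv:
  assumes "smooth_curve_on I \<gamma>" "t \<in> I"
  shows "(curve_deriv I i \<gamma> has_vector_derivative curve_deriv I (Suc i) \<gamma> t) (at t within I)"
  using assms by (simp add: smooth_curve_on_def curve_deriv_def flip: vector_derivative_works)

lemma has_vector_derivative_cong_unique:
  assumes "at t within I \<noteq> bot" "t \<in> I" "\<And>s. s \<in> I \<Longrightarrow> f s = h s"
    and "(f has_vector_derivative D) (at t within I)" "(h has_vector_derivative E) (at t within I)"
  shows "D = E"
proof -
  have "(f has_vector_derivative E) (at t within I)"
    by (rule has_vector_derivative_transform[OF assms(2) _ assms(5)]) (simp add: assms(3))
  with assms(1,4) show ?thesis
    by (rule vector_derivative_unique_within)
qed

lemma cov_deriv_eq:
  assumes "at t within I \<noteq> bot" "t \<in> I" "\<And>s. s \<in> I \<Longrightarrow> V s = W s"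
    and "(W has_vector_derivative D) (at t within I)"
  shows "cov_deriv I \<gamma> V t = tangent_proj (\<gamma> t) D"
proof -
  have "(V has_vector_derivative D) (at t within I)"
    by (rule has_vector_derivative_transform[OF assms(2) _ assms(4)]) (simp add: assms(3))
  with assms(1) show ?thesis
    by (simp add: cov_deriv_def curve_deriv_def vector_derivative_within)
qed

lemma tangent_proj_minus: "tangent_proj p (- v) = - tangent_proj p v"
  by (simp add: tangent_proj_def)

text \<open>Regroups coefficients after \<open>algebra_simps\<close> has distributed scalar
  multiples; the second equation reaches into right-nested sums.\<close>

lemma scaleR_collect:
  fixes x y :: "'a::real_vector"
  shows "a *\<^sub>R x + b *\<^sub>R x = (a + b) *\<^sub>R x"
    and "a *\<^sub>R x + (b *\<^sub>R x + y) = (a + b) *\<^sub>R x + y"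
  by (simp_all add: algebra_simps)

section \<open>Inner products of the derivatives of the curve\<close>

locale unit_speed_spherical_curve =
  fixes I :: "real set" and \<gamma> :: "real \<Rightarrow> 'a::euclidean_space"
  assumes interval: "is_interval I" "interior I \<noteq> {}"
    and spherical: "\<gamma> ` I \<subseteq> sphere 0 1"
    and smooth: "smooth_curve_on I \<gamma>"
    and unit_speed: "\<And>t. t \<in> I \<Longrightarrow> norm (curve_deriv I 1 \<gamma> t) = 1"
begin

text \<open>Indices stay in the form \<open>1\<close>, \<open>2\<close>, ... instead of
  \<open>Suc 0\<close>, so that the facts on \<open>gram 1 j\<close> rewrite.\<close>

declare One_nat_def [simp del] One_nat_def [symmetric, simp]

definition c :: "nat \<Rightarrow> real \<Rightarrow> 'a" where
  "c i = curve_deriv I i \<gamma>"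

definition gram :: "nat \<Rightarrow> nat \<Rightarrow> real \<Rightarrow> real" where
  "gram i j t = c i t \<bullet> c j t"

lemma c_0: "c 0 = \<gamma>"
  by (simp add: c_def curve_deriv_def)

lemma gram_commute: "gram i j t = gram j i t"
  by (simp add: gram_def inner_commute)

lemmas nontrivial = at_within_interval_neq_bot[OF interval]

text \<open>The successor is a separate premise so that numeral indices unify, as in
  \<open>c_deriv[of t 3 2]\<close>.\<close>

lemma c_deriv:
  "t \<in> I \<Longrightarrow> j = Suc i \<Longrightarrow> (c i has_vector_derivative c j t) (at t within I)"
  unfolding c_def using has_vector_derivative_curve_deriv[OF smooth] by blast

lemma gram_deriv:
  assumes "t \<in> I"
  shows "(gram i j has_vector_derivative gram (Suc i) j t + gram i (Suc j) t) (at t within I)"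
  using bounded_bilinear.has_vector_derivative[OF bounded_bilinear_inner
      c_deriv[OF assms refl, of i] c_deriv[OF assms refl, of j]]
  by (simp add: gram_def[abs_def] add.commute)

text \<open>The engine of the relations below: the product rule turns a known
  \<open>gram i j\<close> into a relation between the two products of total order i + j + 1.\<close>

lemma gram_deriv_eq:
  assumes "\<And>s. s \<in> I \<Longrightarrow> gram i j s = f s" "t \<in> I" "(f has_vector_derivative D) (at t within I)"
  shows "gram (Suc i) j t + gram i (Suc j) t = D"
  by (rule has_vector_derivative_cong_unique[OF nontrivial _ _ gram_deriv]) (use assms in auto)

lemma gram_00: "t \<in> I \<Longrightarrow> gram 0 0 t = 1"
  using spherical by (force simp: gram_def c_0 dot_square_norm)

lemma gram_11: "t \<in> I \<Longrightarrow> gram 1 1 t = 1"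
  using unit_speed by (simp add: gram_def c_def dot_square_norm)

lemma gram_01: "t \<in> I \<Longrightarrow> gram 0 1 t = 0"
  using gram_deriv_eq[OF gram_00, of t 0] gram_commute[of 0 1 t] by simp

lemma gram_12: "t \<in> I \<Longrightarrow> gram 1 2 t = 0"
  using gram_deriv_eq[OF gram_11, of t 0] gram_commute[of 1 2 t] by simp

lemma gram_02: "t \<in> I \<Longrightarrow> gram 0 2 t = -1"
  using gram_deriv_eq[OF gram_01, of t 0] gram_11[of t] by simp

lemma gram_03: "t \<in> I \<Longrightarrow> gram 0 3 t = 0"
  using gram_deriv_eq[OF gram_02, of t 0] gram_12[of t] by simp

lemma gram_13: "t \<in> I \<Longrightarrow> gram 1 3 t = - gram 2 2 t"
  using gram_deriv_eq[OF gram_12, of t 0] by simp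

lemma gram_04: "t \<in> I \<Longrightarrow> gram 0 4 t = gram 2 2 t"
  using gram_deriv_eq[OF gram_03, of t 0] gram_13[of t] by simp

lemma gram_22_deriv:
  "t \<in> I \<Longrightarrow> (gram 2 2 has_vector_derivative 2 * gram 2 3 t) (at t within I)"
  using gram_deriv[of t 2 2] gram_commute[of 2 3 t] by simp

lemma gram_23_deriv:
  "t \<in> I \<Longrightarrow> (gram 2 3 has_vector_derivative gram 3 3 t + gram 2 4 t) (at t within I)"
  using gram_deriv[of t 2 3] by simp

lemma gram_14: "t \<in> I \<Longrightarrow> gram 1 4 t = - 3 * gram 2 3 t"
  using gram_deriv_eq[OF gram_13, of t, OF _ _ has_vector_derivative_minus[OF gram_22_deriv]]
  by simp

lemma gram_05: "t \<in> I \<Longrightarrow> gram 0 5 t = 5 * gram 2 3 t"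
  using gram_deriv_eq[OF gram_04, of t, OF _ _ gram_22_deriv] gram_14[of t] by simp

lemma gram_15: "t \<in> I \<Longrightarrow> gram 1 5 t = - 4 * gram 2 4 t - 3 * gram 3 3 t"
  using gram_deriv_eq[OF gram_14, of t, OF _ _ has_vector_derivative_mult_right[OF gram_23_deriv]]
  by simp

lemma gram_06: "t \<in> I \<Longrightarrow> gram 0 6 t = 9 * gram 2 4 t + 8 * gram 3 3 t"
  using gram_deriv_eq[OF gram_05, of t, OF _ _ has_vector_derivative_mult_right[OF gram_23_deriv]]
    gram_15[of t] by simp

section \<open>Iterated covariant derivatives of the tension field\<close>

lemma inner_\<gamma>: "c i t \<bullet> \<gamma> t = gram 0 i t"
  by (simp add: gram_def c_0 inner_commute)

lemma inner_\<gamma>_\<gamma>: "t \<in> I \<Longrightarrow> \<gamma> t \<bullet> \<gamma> t = 1"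
  using gram_00 by (simp add: gram_def c_0)

lemmas gram_simps = c_0 inner_\<gamma> inner_\<gamma>_\<gamma> gram_00 gram_01 gram_02 gram_03 gram_04 gram_05 gram_06

lemma tension_eq: "t \<in> I \<Longrightarrow> tension I \<gamma> t = c 2 t + c 0 t"
  unfolding tension_def
  by (subst cov_deriv_eq[OF nontrivial _ _ c_deriv[of t 2 1]])
    (simp_all add: c_def[symmetric] tangent_proj_def gram_simps)

text \<open>Nothing is projected away here, as \<open>gram 0 3\<close> and \<open>gram 0 1\<close>
  vanish.\<close>

lemma cov_deriv_tension: "t \<in> I \<Longrightarrow> cov_deriv I \<gamma> (tension I \<gamma>) t = c 3 t + c 1 t"
  by (subst cov_deriv_eq[OF nontrivial _ tension_eq
        has_vector_derivative_add[OF c_deriv[of t 3 2] c_deriv[of t 1 0]]])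
    (simp_all add: tangent_proj_def inner_add_left gram_simps)

lemma cov_deriv2_tension:
  "t \<in> I \<Longrightarrow> cov_deriv I \<gamma> (cov_deriv I \<gamma> (tension I \<gamma>)) t = c 4 t + c 2 t + (1 - gram 2 2 t) *\<^sub>R c 0 t"
  by (subst cov_deriv_eq[OF nontrivial _ cov_deriv_tension
        has_vector_derivative_add[OF c_deriv[of t 4 3] c_deriv[of t 2 1]]])
    (simp_all add: tangent_proj_def inner_add_left gram_simps algebra_simps)

lemma rough_laplacian_tension:
  "t \<in> I \<Longrightarrow> rough_laplacian I \<gamma> (tension I \<gamma>) t = - (c 4 t + c 2 t + (1 - gram 2 2 t) *\<^sub>R c 0 t)"
  by (simp only: rough_laplacian_def cov_deriv2_tension)

lemma cov_deriv_rough_laplacian_tension: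
  assumes "t \<in> I"
  shows "cov_deriv I \<gamma> (rough_laplacian I \<gamma> (tension I \<gamma>)) t =
    - (c 5 t + c 3 t + (1 - gram 2 2 t) *\<^sub>R c 1 t - (5 * gram 2 3 t) *\<^sub>R c 0 t)"
proof -
  \<comment> \<open>The shape \<open>0 - 2 * gram 2 3 t\<close> is what \<open>DERIV_const\<close>
    and \<open>DERIV_diff\<close> produce; the scalar factor needs a field derivative, hence the
    folded rules.\<close>
  have "((\<lambda>t. - (c 4 t + c 2 t + (1 - gram 2 2 t) *\<^sub>R c 0 t)) has_vector_derivative
    - (c 5 t + c 3 t + ((1 - gram 2 2 t) *\<^sub>R c 1 t + (0 - 2 * gram 2 3 t) *\<^sub>R c 0 t))) (at t within I)"
    using assms
    by (intro has_vector_derivative_minus has_vector_derivative_add c_deriv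
        has_vector_derivative_scaleR has_vector_derivative_diff has_vector_derivative_const
        gram_22_deriv[folded has_real_derivative_iff_has_vector_derivative]
        DERIV_diff DERIV_const) auto
  from cov_deriv_eq[OF nontrivial[OF assms] assms rough_laplacian_tension this]
  show ?thesis
    using assms
    by (simp add: tangent_proj_minus)
      (simp add: tangent_proj_def inner_simps gram_simps algebra_simps,
       simp add: scaleR_collect)
qed

text \<open>The 7 is 2 + 5, from differentiating \<open>1 - gram 2 2\<close> and the factor \<gamma>
  of the last term. Projection replaces the \<gamma>-coefficient by minus the product of \<gamma>
  with the other terms, where \<open>gram_06\<close> supplies 9 and 8.\<close>

lemma rough_laplacian2_tension:
  assumes "t \<in> I"
  shows "rough_laplacian I \<gamma> (rough_laplacian I \<gamma> (tension I \<gamma>)) t =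
    c 6 t + c 4 t + (1 - gram 2 2 t) *\<^sub>R c 2 t - (7 * gram 2 3 t) *\<^sub>R c 1 t
    + (1 - 2 * gram 2 2 t - 9 * gram 2 4 t - 8 * gram 3 3 t) *\<^sub>R c 0 t"
proof -
  have "((\<lambda>t. - (c 5 t + c 3 t + (1 - gram 2 2 t) *\<^sub>R c 1 t - (5 * gram 2 3 t) *\<^sub>R c 0 t))
    has_vector_derivative
    - (c 6 t + c 4 t + ((1 - gram 2 2 t) *\<^sub>R c 2 t + (0 - 2 * gram 2 3 t) *\<^sub>R c 1 t)
      - ((5 * gram 2 3 t) *\<^sub>R c 1 t + (5 * (gram 3 3 t + gram 2 4 t)) *\<^sub>R c 0 t))) (at t within I)"
    using assms
    by (intro has_vector_derivative_minus has_vector_derivative_add has_vector_derivative_diff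
        c_deriv has_vector_derivative_scaleR DERIV_diff DERIV_const DERIV_cmult
        gram_22_deriv[folded has_real_derivative_iff_has_vector_derivative]
        gram_23_deriv[folded has_real_derivative_iff_has_vector_derivative]) auto
  from cov_deriv_eq[OF nontrivial[OF assms] assms cov_deriv_rough_laplacian_tension this]
  show ?thesis
    using assms
    by (simp add: rough_laplacian_def[of _ _ "rough_laplacian _ _ _"] tangent_proj_minus)
      (simp add: tangent_proj_def inner_simps gram_simps algebra_simps,
       simp add: scaleR_collect)
qed

section \<open>The curvature term and the 3-tension\<close>

lemma k_tension_3:
  assumes t: "t \<in> I"
  shows "k_tension I 3 \<gamma> t =
    c 6 t + 2 *\<^sub>R c 4 t + (2 - gram 2 2 t) *\<^sub>R c 2 t - (4 * gram 2 3 t) *\<^sub>R c 1 t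
    + (2 - 3 * gram 2 2 t - 9 * gram 2 4 t - 8 * gram 3 3 t) *\<^sub>R c 0 t"
proof -
  let ?L = "rough_laplacian I \<gamma> (tension I \<gamma>) t"
  have p: "\<gamma> t \<in> sphere 0 1"
    using spherical t by blast
  \<comment> \<open>\<open>curvature_sphere\<close> applies to tangent vectors only, so
    \<open>?L\<close> and \<open>c 1 t\<close> are checked first.\<close>
  have "?L \<bullet> \<gamma> t = 0"
    using t by (simp add: rough_laplacian_tension inner_simps gram_simps)
  moreover have "c 1 t \<bullet> \<gamma> t = 0"
    using t by (simp add: gram_simps)
  ultimately have "curvature (\<gamma> t) ?L (c 1 t) (c 1 t) = gram 1 1 t *\<^sub>R ?L - (?L \<bullet> c 1 t) *\<^sub>R c 1 t"
    using curvature_sphere[OF p] by (simp add: gram_def)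
  \<comment> \<open>Only \<open>gram 1 4\<close> survives, giving 3 g23; subtracting the curvature
    term thus turns the coefficient -7 g23 of \<gamma>' into -4 g23.\<close>
  moreover have "?L \<bullet> c 1 t = - (gram 1 4 t + gram 1 2 t + (1 - gram 2 2 t) * gram 0 1 t)"
    using t by (simp add: rough_laplacian_tension inner_simps gram_def inner_commute)
  ultimately have "curvature (\<gamma> t) ?L (c 1 t) (c 1 t) = ?L - (3 * gram 2 3 t) *\<^sub>R c 1 t"
    using t by (simp only: gram_11 gram_14 gram_12 gram_01) simp
  then have "k_tension I 3 \<gamma> t =
      rough_laplacian I \<gamma> (rough_laplacian I \<gamma> (tension I \<gamma>)) t - (?L - (3 * gram 2 3 t) *\<^sub>R c 1 t)"
    \<comment> \<open>Unfolding the iterates with exponents 2 and 1 needs \<open>Suc\<close> form,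
      so the rewriting of \<open>Suc 0\<close> to \<open>1\<close> is reversed.\<close>
    by (simp add: k_tension_def c_def numeral_2_eq_2 One_nat_def del: One_nat_def[symmetric])
  also have "\<dots> =
      c 6 t + 2 *\<^sub>R c 4 t + (2 - gram 2 2 t) *\<^sub>R c 2 t - (4 * gram 2 3 t) *\<^sub>R c 1 t
      + (2 - 3 * gram 2 2 t - 9 * gram 2 4 t - 8 * gram 3 3 t) *\<^sub>R c 0 t"
    unfolding rough_laplacian2_tension[OF t] unfolding rough_laplacian_tension[OF t]
    by (simp add: algebra_simps scaleR_2, simp add: scaleR_collect)
  finally show ?thesis .
qed

end

theorem proposition7p2:
  fixes I :: "real set" and \<gamma> :: "real \<Rightarrow> 'a::euclidean_space"
    and g :: "nat \<Rightarrow> nat \<Rightarrow> real \<Rightarrow> real"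
  assumes "is_interval I" and "interior I \<noteq> {}"
    and "\<gamma> ` I \<subseteq> sphere 0 1"
    and "smooth_curve_on I \<gamma>"
    and "\<forall>t\<in>I. norm (curve_deriv I 1 \<gamma> t) = 1"
    and "\<And>i j t. g i j t = curve_deriv I i \<gamma> t \<bullet> curve_deriv I j \<gamma> t"
  shows "k_harmonic I 3 \<gamma> \<longleftrightarrow>
    (\<forall>t\<in>I. curve_deriv I 6 \<gamma> t + 2 *\<^sub>R curve_deriv I 4 \<gamma> t
        + (2 - g 2 2 t) *\<^sub>R curve_deriv I 2 \<gamma> t
        - (4 * g 2 3 t) *\<^sub>R curve_deriv I 1 \<gamma> t
        + (2 - 3 * g 2 2 t - 9 * g 2 4 t - 8 * g 3 3 t) *\<^sub>R \<gamma> t = 0)"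
proof -
  interpret unit_speed_spherical_curve I \<gamma>
    using assms(1-5) by unfold_locales auto
  have "g i j t = gram i j t" for i j t
    by (simp add: assms(6) gram_def c_def)
  then show ?thesis
    by (simp add: k_harmonic_def k_tension_3 c_0 flip: c_def)
qed

end
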